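(* Let $K\ge 2$ and $1\le N\le K$ be integers. For the $(N,K)$ cache network, the memory-rate pair $$\left(\frac{N}{K}\Big(K-2+\frac{K-2+1/N}{K-1}\Big),\ \frac{1}{K-1}\right)$$ is achievable by symmetric caching schemes.
   Context: The $(N,K)$ cache network ($1\le N\le K$): a server holds $N$ files and is connected by an error-free broadcast link to $K$ users $U_1,\dots,U_K$, each with its own cache. Write $[L]=\{1,\dots,L\}$. Scheme. Fix real numbers $M\in[0,N]$, $R\ge 0$. A caching scheme with cache size $M$ and rate $R$ consists of a positive integer $F$ (file size in bits) and the following. The files $W_1,\dots,W_N$ are independent and uniformly distributed on $\{0,1\}^F$. For each $k\in[K]$ the cache content $Z_k$ of user $U_k$ is a deterministic function of $(W_1,\dots,W_N)$ consisting of at most $MF$ bits. A demand is $\mathbf d=(d(1),\dots,d(K))\in[N]^K$, meaning that $U_k$ requests $W_{d(k)}$. $\mathbf D$ is the set of demands in which each of the $N$ files is requested by at least one user. For each $\mathbf d\in\mathbf D$ the broadcast $X_{\mathbf d}$ is a deterministic function of $(W_1,\dots,W_N)$ consisting of at most $RF$ bits, such that for every $k\in[K]$ the file $W_{d(k)}$ is determined by $(Z_k,X_{\mathbf d})$. (The caches do not depend on the demand.) Entropy $H$ is Shannon entropy in bits divided by $F$, so $H(W_n)=1$. Symmetric scheme. A scheme is symmetric if for all permutations $\pi$ of $[K]$ and $\sigma$ of $[N]$ and all $A\subseteq[N]$, $B\subseteq[K]$, $E\subseteq\mathbf D$, $$H\big((W_n)_{n\in A},(Z_k)_{k\in B},(X_{\mathbf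 d})_{\mathbf d\in E}\big)=H\big((W_{\sigma(n)})_{n\in A},(Z_{\pi(k)})_{k\in B},(X_{\sigma\circ\mathbf d\circ\pi^{-1}})_{\mathbf d\in E}\big).$$ A pair $(M,R)$ is achievable by symmetric caching schemes if there is (for some $F$) a symmetric scheme with cache size $M$ and rate $R$. *)

theory Defs
  imports "HOL-Probability.Probability" "HOL-Combinatorics.Permutations"
begin

type_synonym bits = "bool list"
type_synonym files = "nat \<Rightarrow> bits"
type_synonym demand = "nat \<Rightarrow> nat"

definition bit_strings :: "nat \<Rightarrow> bits set" where
  "bit_strings F = {w. length w = F}"

definition file_space :: "nat \<Rightarrow> nat \<Rightarrow> files measure" where
  "file_space N F = PiM {1..N} (\<lambda>_. uniform_count_measure (bit_strings F))"

lemma finite_bit_strings: "finite (bit_strings F)"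
  using finite_lists_length_eq[of "UNIV :: bool set" F] by (simp add: bit_strings_def)

lemma bit_strings_nonempty: "bit_strings F \<noteq> {}"
proof -
  have "replicate F False \<in> bit_strings F"
    by (simp add: bit_strings_def)
  then show ?thesis by blast
qed

lemma space_file_space: "space (file_space N F) = ({1..N} \<rightarrow>\<^sub>E bit_strings F)"
  by (simp add: file_space_def space_PiM space_uniform_count_measure)

lemma prob_space_file_space: "prob_space (file_space N F)"
  unfolding file_space_def
  by (intro prob_space_PiM prob_space_uniform_count_measure finite_bit_strings
      bit_strings_nonempty)

text \<open>Shannon entropy in bits per file bit. The logarithm has base \<open>2\<close>, and the random variable
  takes its values in the discrete space on its (finite) range.\<close>

definition norm_entropy :: "nat \<Rightarrow> nat \<Rightarrow> (files \<Rightarrow> 'a) \<Rightarrow> real" where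
  "norm_entropy N F Y =
     prob_space.entropy (file_space N F) 2 (count_space (Y ` space (file_space N F))) Y / real F"

text \<open>Demands are extensional functions, so that two demands agreeing on all users are equal.\<close>

definition full_demands :: "nat \<Rightarrow> nat \<Rightarrow> demand set" where
  "full_demands N K = {d \<in> {1..K} \<rightarrow>\<^sub>E {1..N}. d ` {1..K} = {1..N}}"

definition permute_demand ::
    "nat \<Rightarrow> (nat \<Rightarrow> nat) \<Rightarrow> (nat \<Rightarrow> nat) \<Rightarrow> demand \<Rightarrow> demand" where
  "permute_demand K \<pi> \<sigma> d = restrict (\<sigma> \<circ> d \<circ> inv \<pi>) {1..K}"

text \<open>A message of at most \<open>b\<close> bits is a string of some length \<open>m \<le> b\<close> that does not depend on
  the files. With variable-length strings the length would carry additional information.\<close>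

definition bounded_message :: "nat \<Rightarrow> nat \<Rightarrow> real \<Rightarrow> (files \<Rightarrow> bits) \<Rightarrow> bool" where
  "bounded_message N F b Y \<longleftrightarrow>
     (\<exists>m::nat. real m \<le> b \<and> (\<forall>w \<in> space (file_space N F). Y w \<in> bit_strings m))"

text \<open>\<open>Z k w\<close> is the cache content of user \<open>k\<close> and \<open>X d w\<close> the broadcast for demand \<open>d\<close> when the
  files are \<open>w\<close>.\<close>

definition caching_scheme ::
    "nat \<Rightarrow> nat \<Rightarrow> real \<Rightarrow> real \<Rightarrow> nat \<Rightarrow> (nat \<Rightarrow> files \<Rightarrow> bits) \<Rightarrow> (demand \<Rightarrow> files \<Rightarrow> bits) \<Rightarrow> bool"
where
  "caching_scheme N K M R F Z X \<longleftrightarrow>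
     0 \<le> M \<and> M \<le> real N \<and> 0 \<le> R \<and> 0 < F \<and>
     (\<forall>k \<in> {1..K}. bounded_message N F (M * real F) (Z k)) \<and>
     (\<forall>d \<in> full_demands N K. bounded_message N F (R * real F) (X d)) \<and>
     (\<forall>d \<in> full_demands N K. \<forall>k \<in> {1..K}.
        \<exists>g :: bits \<Rightarrow> bits \<Rightarrow> bits. \<forall>w \<in> space (file_space N F). w (d k) = g (Z k w) (X d w))"

definition symmetric_scheme ::
    "nat \<Rightarrow> nat \<Rightarrow> nat \<Rightarrow> (nat \<Rightarrow> files \<Rightarrow> bits) \<Rightarrow> (demand \<Rightarrow> files \<Rightarrow> bits) \<Rightarrow> bool" where
  "symmetric_scheme N K F Z X \<longleftrightarrow>
     (\<forall>\<pi> \<sigma> A B E. \<pi> permutes {1..K} \<longrightarrow> \<sigma> permutes {1..N} \<longrightarrow>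
        A \<subseteq> {1..N} \<longrightarrow> B \<subseteq> {1..K} \<longrightarrow> E \<subseteq> full_demands N K \<longrightarrow>
        norm_entropy N F (\<lambda>w. (\<lambda>n\<in>A. w n, \<lambda>k\<in>B. Z k w, \<lambda>d\<in>E. X d w)) =
        norm_entropy N F
          (\<lambda>w. (\<lambda>n\<in>A. w (\<sigma> n), \<lambda>k\<in>B. Z (\<pi> k) w, \<lambda>d\<in>E. X (permute_demand K \<pi> \<sigma> d) w)))"

definition achievable_by_symmetric_schemes :: "nat \<Rightarrow> nat \<Rightarrow> real \<times> real \<Rightarrow> bool" where
  "achievable_by_symmetric_schemes N K = (\<lambda>(M, R).
     \<exists>F Z X. caching_scheme N K M R F Z X \<and> symmetric_scheme N K F Z X)"

end

theory Submission
  imports Defs "HOL-Library.Z2"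
begin

text \<open>Symbols are elements of the field with four elements, that is, pairs of bits. A file \<open>n\<close>
  consists of vectors \<open>w\<^bsub>n,1\<^esub>, \<dots>, w\<^bsub>n,K\<^esub>\<close> of \<open>K\<close> symbols, modulo adding one vector to all of them; this is
  normalized by \<open>w\<^bsub>n,K\<^esub> = 0\<close>. User \<open>k\<close> stores the differences of the vectors other than \<open>w\<^bsub>n,k\<^esub>\<close> of
  every file and, for some \<open>j \<noteq> k\<close>, the single coded symbol \<open>\<Sum>\<^sub>n (w\<^bsub>n,k\<^esub> - w\<^bsub>n,j\<^esub>)\<^sub>k\<close>. For the demand \<open>d\<close>
  the \<open>K\<close> symbols \<open>\<Sum>\<^sub>n (w\<^bsub>n,c\<^esub>)\<^sub>c - \<Sum>\<^sub>i t\<^sub>i (w\<^bsub>d(i),i\<^esub>)\<^sub>c\<close> are sent, where the nonzero weights \<open>t\<^sub>i\<close> of the users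
  requesting the same file add up to \<open>1\<close>, so that the broadcast is well defined modulo the
  shifts. After shifting \<open>w\<^bsub>n,j\<^esub>\<close> to \<open>0\<close>, the only interference left at user \<open>k\<close> is the coded symbol.
  Symmetry is then obtained by running this scheme under all renamings of users and files.\<close>

subsection \<open>Entropy on the file space\<close>

lemma finite_space_file_space: "finite (space (file_space N F))"
  by (simp add: space_file_space finite_PiE finite_bit_strings)

text \<open>Singletons are boxes in a finite product, and every subset of a finite space is a finite
  union of them. Consequently every function of the files is a simple function and raises no
  measurability question.\<close>

lemma sets_file_space: "sets (file_space N F) = Pow (space (file_space N F))"
proof
  show "sets (file_space N F) \<subseteq> Pow (space (file_space N F))"
    by (rule sets.space_closed)
  have sing: "{w} \<in> sets (file_space N F)" if w: "w \<in> space (file_space N F)" for w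
  proof -
    have "{w} = (\<Pi>\<^sub>E n\<in>{1..N}. {w n})"
      using w by (subst PiE_singleton) (auto simp: space_file_space PiE_iff)
    also have "\<dots> \<in> sets (file_space N F)"
      unfolding file_space_def
      by (rule sets_PiM_I_finite)
        (use w in \<open>auto simp: space_file_space PiE_iff sets_uniform_count_measure\<close>)
    finally show ?thesis .
  qed
  show "Pow (space (file_space N F)) \<subseteq> sets (file_space N F)"
  proof safe
    fix A assume A: "A \<subseteq> space (file_space N F)"
    have "(\<Union>w\<in>A. {w}) \<in> sets (file_space N F)"
      using A finite_space_file_space[of N F]
      by (intro sets.finite_UN sing) (auto intro: finite_subset)
    then show "A \<in> sets (file_space N F)" by simp
  qed
qed

lemma measure_file_space_singleton:
  assumes w: "w \<in> space (file_space N F)"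
  shows "measure (file_space N F) {w} = 1 / real (card (bit_strings F)) ^ N"
proof -
  interpret product_prob_space "\<lambda>_. uniform_count_measure (bit_strings F)" "{1..N}"
    by (intro product_prob_spaceI prob_space_uniform_count_measure finite_bit_strings
        bit_strings_nonempty)
  interpret finite_product_prob_space "\<lambda>_. uniform_count_measure (bit_strings F)" "{1..N}"
    by unfold_locales simp
  have "{w} = (\<Pi>\<^sub>E n\<in>{1..N}. {w n})"
    using w by (subst PiE_singleton) (auto simp: space_file_space PiE_iff)
  then have "measure (file_space N F) {w}
      = (\<Prod>n\<in>{1..N}. measure (uniform_count_measure (bit_strings F)) {w n})"
    unfolding file_space_def
    using w by (simp only:, intro prob_times)
      (auto simp: sets_uniform_count_measure space_file_space PiE_iff)
  also have "\<dots> = (\<Prod>n\<in>{1..N}. 1 / real (card (bit_strings F)))"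
    using w by (intro prod.cong refl)
      (auto simp: measure_uniform_count_measure finite_bit_strings space_file_space PiE_iff)
  finally show ?thesis by (simp add: power_divide)
qed

lemma measure_file_space:
  assumes "A \<subseteq> space (file_space N F)"
  shows "measure (file_space N F) A = real (card A) / real (card (bit_strings F)) ^ N"
proof -
  have fin: "finite A"
    using assms finite_space_file_space finite_subset by blast
  interpret prob_space "file_space N F" by (rule prob_space_file_space)
  have "measure (file_space N F) A = (\<Sum>w\<in>A. measure (file_space N F) {w})"
    using assms fin by (intro finite_measure_eq_sum_singleton) (auto simp: sets_file_space)
  also have "\<dots> = (\<Sum>w\<in>A. 1 / real (card (bit_strings F)) ^ N)"
    using assms by (intro sum.cong refl measure_file_space_singleton) auto
  finally show ?thesis by simp
qed

text \<open>Summing over file vectors instead of values makes the formula depend on \<open>Y\<close>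
  only through its fibres: a fibre of \<open>m\<close> vectors has probability \<open>m / c\<close>,
  which is spread evenly over its members.\<close>

lemma norm_entropy_eq_sum_fibres:
  fixes N F :: nat and Y :: "files \<Rightarrow> 'a"
  defines "\<Omega> \<equiv> space (file_space N F)" and "c \<equiv> real (card (bit_strings F)) ^ N"
  shows "norm_entropy N F Y = - (\<Sum>w\<in>\<Omega>. log 2 (real (card {w'\<in>\<Omega>. Y w' = Y w}) / c) / c) / real F"
proof -
  let ?M = "file_space N F"
  interpret information_space ?M 2
    by (intro information_space.intro prob_space_file_space information_space_axioms.intro) simp
  define f where "f y = real (card {w\<in>\<Omega>. Y w = y}) / c" for y
  have fin: "finite \<Omega>"
    unfolding \<Omega>_def by (rule finite_space_file_space)
  have f: "f y = measure ?M (Y -` {y} \<inter> space ?M)" for y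
    unfolding f_def c_def \<Omega>_def by (subst measure_file_space) (auto intro!: arg_cong[where f = card])
  have "simple_function ?M Y"
    using fin by (auto simp: simple_function_def sets_file_space \<Omega>_def)
  then have "simple_distributed ?M Y f"
    by (rule simple_distributedI) (simp_all add: f)
  then have "entropy 2 (count_space (Y ` space ?M)) Y = - (\<Sum>y\<in>Y ` \<Omega>. f y * log 2 (f y))"
    unfolding \<Omega>_def by (rule entropy_simple_distributed)
  also have "(\<Sum>y\<in>Y ` \<Omega>. f y * log 2 (f y)) = (\<Sum>y\<in>Y ` \<Omega>. \<Sum>w | w \<in> \<Omega> \<and> Y w = y. log 2 (f (Y w)) / c)"
    by (intro sum.cong refl) (simp add: f_def)
  also have "\<dots> = (\<Sum>w\<in>\<Omega>. log 2 (f (Y w)) / c)"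
    by (rule sum.image_gen[OF fin, symmetric])
  finally show ?thesis
    by (simp add: norm_entropy_def f_def)
qed

text \<open>Entropy depends only on the partition of the file space into fibres.\<close>

lemma norm_entropy_bij_cong:
  assumes bij: "bij_betw \<phi> (space (file_space N F)) (space (file_space N F))"
    and fibres: "\<And>w w'. w \<in> space (file_space N F) \<Longrightarrow> w' \<in> space (file_space N F) \<Longrightarrow>
      Y' w = Y' w' \<longleftrightarrow> Y (\<phi> w) = Y (\<phi> w')"
  shows "norm_entropy N F Y' = norm_entropy N F Y"
proof -
  define \<Omega> where "\<Omega> = space (file_space N F)"
  note bij = bij[folded \<Omega>_def] and fibres = fibres[folded \<Omega>_def]
  have "card {v\<in>\<Omega>. Y' v = Y' w} = card {v\<in>\<Omega>. Y v = Y (\<phi> w)}" if w: "w \<in> \<Omega>" for w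
  proof (rule bij_betw_same_card[of \<phi>])
    show "bij_betw \<phi> {v \<in> \<Omega>. Y' v = Y' w} {v \<in> \<Omega>. Y v = Y (\<phi> w)}"
      unfolding bij_betw_def
    proof
      show "inj_on \<phi> {v \<in> \<Omega>. Y' v = Y' w}"
        using bij by (auto simp: bij_betw_def intro: inj_on_subset)
      show "\<phi> ` {v \<in> \<Omega>. Y' v = Y' w} = {v \<in> \<Omega>. Y v = Y (\<phi> w)}"
        using bij_betw_imp_surj_on[OF bij] fibres w by (auto 0 3)
    qed
  qed
  then show ?thesis
    unfolding norm_entropy_eq_sum_fibres \<Omega>_def[symmetric]
    by (subst sum.reindex_bij_betw[OF bij, symmetric]) simp
qed

text \<open>This turns a count of attained values into a message length. An injective recoding keeps
  the fibres, hence decodability and all entropies.\<close>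

lemma ex_bounded_encoding:
  assumes "finite T" "card T \<le> 2 ^ m"
  shows "\<exists>e. inj_on e T \<and> e ` T \<subseteq> bit_strings m"
proof -
  have "card (bit_strings m) = 2 ^ m"
    using card_lists_length_eq[of "UNIV :: bool set" m] by (simp add: bit_strings_def)
  then show ?thesis
    using assms card_le_inj[OF assms(1) finite_bit_strings, of m] by auto
qed

lemma permute_demand_in_full_demands:
  assumes "\<pi> permutes {1..K}" "\<sigma> permutes {1..N}" "d \<in> full_demands N K"
  shows "permute_demand K \<pi> \<sigma> d \<in> full_demands N K"
proof -
  have d: "d \<in> {1..K} \<rightarrow>\<^sub>E {1..N}" "d ` {1..K} = {1..N}"
    using assms(3) by (auto simp: full_demands_def)
  have "permute_demand K \<pi> \<sigma> d ` {1..K} = \<sigma> ` d ` inv \<pi> ` {1..K}"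
    by (auto simp: permute_demand_def image_comp)
  also have "\<dots> = {1..N}"
    using assms by (simp only: permutes_image[OF permutes_inv[OF assms(1)]] d permutes_image[OF assms(2)])
  finally have im: "permute_demand K \<pi> \<sigma> d ` {1..K} = {1..N}" .
  moreover have "permute_demand K \<pi> \<sigma> d \<in> {1..K} \<rightarrow>\<^sub>E {1..N}"
    using im by (auto simp only: PiE_iff permute_demand_def restrict_extensional)
  ultimately show ?thesis by (simp add: full_demands_def)
qed

text \<open>Renamings act on demands as a group; the inner \<open>restrict\<close> is harmless
  because \<open>inv \<pi>\<close> preserves \<open>{1..K}\<close>. Thus a renaming of the
  symmetrized scheme can be absorbed into the index of a block.\<close>

lemma permute_demand_comp:
  assumes "\<alpha> permutes {1..K}" "\<pi> permutes {1..K}"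
  shows "permute_demand K \<pi> \<sigma> (permute_demand K \<alpha> \<beta> d) = permute_demand K (\<pi> \<circ> \<alpha>) (\<sigma> \<circ> \<beta>) d"
proof
  fix i
  have "inv \<pi> i \<in> {1..K} \<longleftrightarrow> i \<in> {1..K}"
    using permutes_in_image[OF permutes_inv[OF assms(2)]] .
  then show "permute_demand K \<pi> \<sigma> (permute_demand K \<alpha> \<beta> d) i
      = permute_demand K (\<pi> \<circ> \<alpha>) (\<sigma> \<circ> \<beta>) d i"
    using permutes_inv_o(1)[OF assms(1)]
    by (auto simp: permute_demand_def o_inv_distrib[OF permutes_bij[OF assms(2)] permutes_bij[OF assms(1)]])
qed


subsection \<open>Symmetrization\<close>

lemma restrict_eq_iff: "restrict f A = restrict g A \<longleftrightarrow> (\<forall>x\<in>A. f x = g x)"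
  by (metis restrict_apply' restrict_ext)

text \<open>A scheme is symmetrized by running it in parallel on one block of each file for every pair
  \<open>(\<pi>, \<sigma>)\<close>, with users and files renamed by \<open>\<pi>\<close> and \<open>\<sigma>\<close>: renaming the users and files of the
  new scheme only permutes its blocks. The contents of a block may be taken from any set of
  \<open>2\<close>-power size, and only the numbers of values of the caches and broadcasts matter.\<close>

lemma achievable_by_symmetrization:
  fixes C :: "'a set" and Z :: "nat \<Rightarrow> (nat \<Rightarrow> 'a) \<Rightarrow> 'z" and X :: "demand \<Rightarrow> (nat \<Rightarrow> 'a) \<Rightarrow> 'x"
    and N K F a b :: nat and M R :: real
  defines "\<Omega> \<equiv> {1..N} \<rightarrow>\<^sub>E C"
  assumes M: "0 \<le> M" "M \<le> real N" and R: "0 \<le> R" and F: "0 < F"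
    and C: "finite C" "card C = 2 ^ F"
    and Z: "\<And>k. k \<in> {1..K} \<Longrightarrow> card (Z k ` \<Omega>) \<le> 2 ^ a" "real a \<le> M * real F"
    and X: "\<And>d. d \<in> full_demands N K \<Longrightarrow> card (X d ` \<Omega>) \<le> 2 ^ b" "real b \<le> R * real F"
    and decodable: "\<And>d k v v'. d \<in> full_demands N K \<Longrightarrow> k \<in> {1..K} \<Longrightarrow> v \<in> \<Omega> \<Longrightarrow> v' \<in> \<Omega> \<Longrightarrow>
      Z k v = Z k v' \<Longrightarrow> X d v = X d v' \<Longrightarrow> v (d k) = v' (d k)"
  shows "achievable_by_symmetric_schemes N K (M, R)"
proof -
  define S where "S = {\<pi>. \<pi> permutes {1..K}} \<times> {\<sigma>. \<sigma> permutes {1..N}}"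
  define c where "c = card S"
  have finS: "finite S"
    by (simp add: S_def finite_permutations)
  have "(id, id) \<in> S"
    by (simp add: S_def permutes_id)
  then have c: "0 < c"
    using finS by (auto simp: c_def card_gt_0_iff)
  have fin\<Omega>: "finite \<Omega>"
    using C by (simp add: \<Omega>_def finite_PiE)
  define W where "W = space (file_space N (F * c))"
  have W: "w \<in> W \<longleftrightarrow> w \<in> {1..N} \<rightarrow>\<^sub>E bit_strings (F * c)" for w
    by (simp add: W_def space_file_space)
  have finW: "finite W"
    by (simp add: W_def finite_space_file_space)

  \<comment> \<open>A file of \<open>F * c\<close> bits holds one element of \<open>C\<close> for
    each of the \<open>c\<close> blocks, since both sides equal \<open>2 ^ (F * c)\<close>;
    \<open>dc\<close> is any such identification.\<close>
  have "card (bit_strings (F * c)) = card (S \<rightarrow>\<^sub>E C)"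
    using card_lists_length_eq[of "UNIV :: bool set" "F * c"] C finS
    by (simp add: bit_strings_def card_funcsetE c_def power_mult)
  then obtain dc where dc: "bij_betw dc (bit_strings (F * c)) (S \<rightarrow>\<^sub>E C)"
    using finite_same_card_bij[OF finite_bit_strings, of "S \<rightarrow>\<^sub>E C"] finS C by (auto intro: finite_PiE)
  have dc_in: "dc x \<in> S \<rightarrow>\<^sub>E C" if "x \<in> bit_strings (F * c)" for x
    using dc that by (auto simp: bij_betw_def)
  have dc_inj: "x = y" if "x \<in> bit_strings (F * c)" "y \<in> bit_strings (F * c)"
      "\<And>g. g \<in> S \<Longrightarrow> dc x g = dc y g" for x y
    using that dc_in PiE_ext[of "dc x" S "\<lambda>_. C" "dc y"] dc by (auto simp: bij_betw_def inj_on_def)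

  \<comment> \<open>In block \<open>g\<close>, user \<open>k\<close> plays the role of user
    \<open>fst g k\<close> and file \<open>m\<close> that of file \<open>snd g m\<close>. Hence the
    base scheme's file \<open>n\<close> is read from file \<open>inv (snd g) n\<close>.\<close>
  define blk where "blk w g = (\<lambda>n\<in>{1..N}. dc (w (inv (snd g) n)) g)" for w g
  have file_in: "w n \<in> bit_strings (F * c)" if "w \<in> W" "n \<in> {1..N}" for w n
    using that unfolding W by (rule PiE_mem)
  have blk_in: "blk w g \<in> \<Omega>" if w: "w \<in> W" and g: "g \<in> S" for w g
  proof -
    have "inv (snd g) n \<in> {1..N}" if "n \<in> {1..N}" for n
      using permutes_in_image[OF permutes_inv, of "snd g" "{1..N}" n] g that
      unfolding S_def by auto
    then have "dc (w (inv (snd g) n)) g \<in> C" if "n \<in> {1..N}" for n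
      using dc_in[OF file_in[OF w]] g that by (auto simp del: atLeastAtMost_iff)
    then show ?thesis
      by (auto simp: \<Omega>_def blk_def)
  qed

  define Zb where "Zb k w = (\<lambda>g\<in>S. Z (fst g k) (blk w g))" for k w
  define Xb where "Xb d w = (\<lambda>g\<in>S. X (permute_demand K (fst g) (snd g) d) (blk w g))" for d w
  have "\<exists>e. inj_on e (Zb k ` W) \<and> e ` Zb k ` W \<subseteq> bit_strings (a * c)" if k: "k \<in> {1..K}" for k
  proof (rule ex_bounded_encoding)
    show "finite (Zb k ` W)" using finW by simp
    have "Zb k ` W \<subseteq> (\<Pi>\<^sub>E g\<in>S. Z (fst g k) ` \<Omega>)"
      using blk_in by (auto simp: Zb_def)
    then have "card (Zb k ` W) \<le> card (\<Pi>\<^sub>E g\<in>S. Z (fst g k) ` \<Omega>)"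
      by (intro card_mono finite_PiE finS finite_imageI fin\<Omega>)
    also have "\<dots> = (\<Prod>g\<in>S. card (Z (fst g k) ` \<Omega>))"
      by (rule card_PiE[OF finS])
    also have "\<dots> \<le> (\<Prod>g\<in>S. 2 ^ a)"
    proof (intro prod_mono conjI Z(1))
      fix g assume "g \<in> S"
      then show "fst g k \<in> {1..K}"
        using permutes_in_image[of "fst g" "{1..K}" k] k unfolding S_def by auto
    qed simp
    also have "\<dots> = 2 ^ (a * c)"
      by (simp add: c_def power_mult)
    finally show "card (Zb k ` W) \<le> 2 ^ (a * c)" .
  qed
  then obtain eZ where eZ: "\<And>k. k \<in> {1..K} \<Longrightarrow> inj_on (eZ k) (Zb k ` W)"
      "\<And>k. k \<in> {1..K} \<Longrightarrow> eZ k ` Zb k ` W \<subseteq> bit_strings (a * c)"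
    by metis
  have "\<exists>e. inj_on e (Xb d ` W) \<and> e ` Xb d ` W \<subseteq> bit_strings (b * c)" if d: "d \<in> full_demands N K" for d
  proof (rule ex_bounded_encoding)
    let ?p = "\<lambda>g. permute_demand K (fst g) (snd g) d"
    show "finite (Xb d ` W)" using finW by simp
    have "Xb d ` W \<subseteq> (\<Pi>\<^sub>E g\<in>S. X (?p g) ` \<Omega>)"
      using blk_in by (auto simp: Xb_def)
    then have "card (Xb d ` W) \<le> card (\<Pi>\<^sub>E g\<in>S. X (?p g) ` \<Omega>)"
      by (intro card_mono finite_PiE finS finite_imageI fin\<Omega>)
    also have "\<dots> = (\<Prod>g\<in>S. card (X (?p g) ` \<Omega>))"
      by (rule card_PiE[OF finS])
    also have "\<dots> \<le> (\<Prod>g\<in>S. 2 ^ b)"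
    proof (intro prod_mono conjI X(1))
      fix g assume "g \<in> S"
      then show "?p g \<in> full_demands N K"
        using d by (auto simp: S_def intro: permute_demand_in_full_demands)
    qed simp
    also have "\<dots> = 2 ^ (b * c)"
      by (simp add: c_def power_mult)
    finally show "card (Xb d ` W) \<le> 2 ^ (b * c)" .
  qed
  then obtain eX where eX: "\<And>d. d \<in> full_demands N K \<Longrightarrow> inj_on (eX d) (Xb d ` W)"
      "\<And>d. d \<in> full_demands N K \<Longrightarrow> eX d ` Xb d ` W \<subseteq> bit_strings (b * c)"
    by metis
  define Z' where "Z' k w = eZ k (Zb k w)" for k w
  define X' where "X' d w = eX d (Xb d w)" for d w
  \<comment> \<open>The encodings are injective on the attained values, so equality of messages is
    equality in every block.\<close>
  have Z'_eq: "Z' k w = Z' k w' \<longleftrightarrow> (\<forall>g\<in>S. Z (fst g k) (blk w g) = Z (fst g k) (blk w' g))"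
    if "k \<in> {1..K}" "w \<in> W" "w' \<in> W" for k w w'
  proof -
    have "Z' k w = Z' k w' \<longleftrightarrow> Zb k w = Zb k w'"
      unfolding Z'_def using that by (intro inj_on_eq_iff[OF eZ(1)] imageI)
    then show ?thesis by (simp add: Zb_def restrict_eq_iff)
  qed
  have X'_eq: "X' d w = X' d w' \<longleftrightarrow> (\<forall>g\<in>S. X (permute_demand K (fst g) (snd g) d) (blk w g)
      = X (permute_demand K (fst g) (snd g) d) (blk w' g))"
    if "d \<in> full_demands N K" "w \<in> W" "w' \<in> W" for d w w'
  proof -
    have "X' d w = X' d w' \<longleftrightarrow> Xb d w = Xb d w'"
      unfolding X'_def using that by (intro inj_on_eq_iff[OF eX(1)] imageI)
    then show ?thesis by (simp add: Xb_def restrict_eq_iff)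
  qed

  have decode: "w (d k) = w' (d k)"
    if d: "d \<in> full_demands N K" and k: "k \<in> {1..K}" and w: "w \<in> W" and w': "w' \<in> W"
      and eq: "Z' k w = Z' k w'" "X' d w = X' d w'" for d k w w'
  proof -
    have dk: "d k \<in> {1..N}"
      using d k by (auto simp: full_demands_def)
    show ?thesis
    proof (rule dc_inj)
      fix g assume g: "g \<in> S"
      then have p: "fst g permutes {1..K}" and s: "snd g permutes {1..N}"
        by (auto simp: S_def)
      let ?d = "permute_demand K (fst g) (snd g) d"
      have pk: "fst g k \<in> {1..K}"
        using permutes_in_image[OF p] k by simp
      \<comment> \<open>In block \<open>g\<close> the base user \<open>fst g k\<close> requests the
        base file \<open>snd g (d k)\<close>, whose content is block \<open>g\<close> of the file
        \<open>d k\<close>.\<close>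
      have "blk w g (?d (fst g k)) = blk w' g (?d (fst g k))"
      proof (rule decodable[of ?d "fst g k"])
        show "?d \<in> full_demands N K"
          using p s d by (rule permute_demand_in_full_demands)
      qed (use g w w' d k eq pk blk_in in \<open>simp_all add: Z'_eq X'_eq\<close>)
      moreover have "?d (fst g k) = snd g (d k)"
        using pk permutes_inverses(2)[OF p] by (simp add: permute_demand_def)
      moreover have "blk u g (snd g (d k)) = dc (u (d k)) g" for u
        using permutes_in_image[OF s] permutes_inverses(2)[OF s] dk by (simp add: blk_def)
      ultimately show "dc (w (d k)) g = dc (w' (d k)) g" by simp
    qed (use w w' dk file_in in blast)+
  qed

  have "caching_scheme N K M R (F * c) Z' X'"
    unfolding caching_scheme_def W_def[symmetric]
  proof (intro conjI ballI)
    show "0 < F * c" using F c by simp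
    fix k assume k: "k \<in> {1..K}"
    have "real (a * c) \<le> M * real (F * c)"
      using mult_right_mono[OF Z(2), of "real c"] by (simp add: mult.assoc)
    then show "bounded_message N (F * c) (M * real (F * c)) (Z' k)"
      using eZ(2)[OF k] unfolding bounded_message_def W_def[symmetric] Z'_def
      by (intro exI[of _ "a * c"]) blast
  next
    fix d assume d: "d \<in> full_demands N K"
    have "real (b * c) \<le> R * real (F * c)"
      using mult_right_mono[OF X(2), of "real c"] by (simp add: mult.assoc)
    then show "bounded_message N (F * c) (R * real (F * c)) (X' d)"
      using eX(2)[OF d] unfolding bounded_message_def W_def[symmetric] X'_def
      by (intro exI[of _ "b * c"]) blast
    fix k assume k: "k \<in> {1..K}"
    \<comment> \<open>The decoder picks any file vector consistent with the cache and the broadcast;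
      by \<open>decode\<close> all such vectors agree on the requested file.\<close>
    define dec where "dec z x = (SOME w. w \<in> W \<and> Z' k w = z \<and> X' d w = x) (d k)" for z x
    have "w (d k) = dec (Z' k w) (X' d w)" if w: "w \<in> W" for w
    proof -
      let ?u = "SOME u. u \<in> W \<and> Z' k u = Z' k w \<and> X' d u = X' d w"
      have "?u \<in> W \<and> Z' k ?u = Z' k w \<and> X' d ?u = X' d w"
        by (rule someI[of _ w]) (simp add: w)
      then show ?thesis
        using decode[OF d k, of ?u w] w by (simp add: dec_def)
    qed
    then show "\<exists>g. \<forall>w\<in>W. w (d k) = g (Z' k w) (X' d w)" by blast
  qed (use M R in simp_all)

  moreover have "symmetric_scheme N K (F * c) Z' X'"
    unfolding symmetric_scheme_def
  proof (intro allI impI)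
    fix \<alpha> \<beta> A B E
    assume \<alpha>: "\<alpha> permutes {1..K}" and \<beta>: "\<beta> permutes {1..N}"
      and A: "A \<subseteq> {1..N}" and B: "B \<subseteq> {1..K}" and E: "E \<subseteq> full_demands N K"
    \<comment> \<open>Right multiplication by \<open>(\<alpha>, \<beta>)\<close> permutes the
      blocks, with inverse \<open>h'\<close>: user \<open>\<alpha> k\<close> in block
      \<open>g\<close> plays the same role as user \<open>k\<close> in block
      \<open>h g\<close>.\<close>
    define h where "h g = (fst g \<circ> \<alpha>, snd g \<circ> \<beta>)" for g :: "(nat \<Rightarrow> nat) \<times> (nat \<Rightarrow> nat)"
    define h' where "h' g = (fst g \<circ> inv \<alpha>, snd g \<circ> inv \<beta>)" for g :: "(nat \<Rightarrow> nat) \<times> (nat \<Rightarrow> nat)"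
    have h_in: "h g \<in> S" if "g \<in> S" for g
      using that \<alpha> \<beta> by (auto simp: h_def S_def intro: permutes_compose)
    have h'_in: "h' g \<in> S" if "g \<in> S" for g
      using that \<alpha> \<beta> by (auto simp: h'_def S_def intro: permutes_compose permutes_inv)
    have h'h: "h' (h g) = g" and hh': "h (h' g) = g" for g
      using permutes_inv_o[OF \<alpha>] permutes_inv_o[OF \<beta>]
      by (simp_all add: h_def h'_def o_assoc[symmetric])
    have all_h: "(\<forall>g\<in>S. P (h g)) \<longleftrightarrow> (\<forall>g\<in>S. P g)" for P
      using h_in h'_in hh' by metis
    have \<beta>_in: "\<beta> n \<in> {1..N}" if "n \<in> {1..N}" for n
      using permutes_in_image[OF \<beta>] that by blast

    \<comment> \<open>\<open>\<phi>\<close> moves file \<open>\<beta> n\<close> to position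
      \<open>n\<close> and its block \<open>g\<close> to block \<open>h g\<close>. It is a bijection
      of the file space that carries the renamed scheme to the original one.\<close>
    define \<phi> where "\<phi> w = (\<lambda>n\<in>{1..N}. the_inv_into (bit_strings (F * c)) dc (\<lambda>g\<in>S. dc (w (\<beta> n)) (h' g)))"
      for w :: files
    have \<phi>n: "\<phi> w n \<in> bit_strings (F * c)" "dc (\<phi> w n) = (\<lambda>g\<in>S. dc (w (\<beta> n)) (h' g))"
      if w: "w \<in> W" and n: "n \<in> {1..N}" for w n
    proof -
      have "(\<lambda>g\<in>S. dc (w (\<beta> n)) (h' g)) \<in> S \<rightarrow>\<^sub>E C"
        using dc_in[OF file_in[OF w \<beta>_in[OF n]]] h'_in by auto
      then have im: "(\<lambda>g\<in>S. dc (w (\<beta> n)) (h' g)) \<in> dc ` bit_strings (F * c)"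
        using bij_betw_imp_surj_on[OF dc] by simp
      have inj: "inj_on dc (bit_strings (F * c))"
        using dc by (rule bij_betw_imp_inj_on)
      have \<phi>_eq: "\<phi> w n = the_inv_into (bit_strings (F * c)) dc (\<lambda>g\<in>S. dc (w (\<beta> n)) (h' g))"
        using n by (simp add: \<phi>_def)
      show "\<phi> w n \<in> bit_strings (F * c)"
        unfolding \<phi>_eq by (rule the_inv_into_into[OF inj im subset_refl])
      show "dc (\<phi> w n) = (\<lambda>g\<in>S. dc (w (\<beta> n)) (h' g))"
        unfolding \<phi>_eq by (rule f_the_inv_into_f[OF inj im])
    qed
    have \<phi>_in: "\<phi> w \<in> W" if "w \<in> W" for w
      unfolding W using \<phi>n(1)[OF that] by (auto simp: \<phi>_def)
    have \<phi>_h: "dc (\<phi> w n) (h g) = dc (w (\<beta> n)) g" if "w \<in> W" "n \<in> {1..N}" "g \<in> S" for w n g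
      using \<phi>n(2)[OF that(1,2)] h_in[OF that(3)] by (simp add: h'h)
    have file_eq: "w (\<beta> n) = w' (\<beta> n) \<longleftrightarrow> \<phi> w n = \<phi> w' n"
      if "w \<in> W" "w' \<in> W" "n \<in> {1..N}" for w w' n
    proof
      assume "w (\<beta> n) = w' (\<beta> n)"
      then show "\<phi> w n = \<phi> w' n" by (simp add: \<phi>_def)
    next
      assume eq: "\<phi> w n = \<phi> w' n"
      show "w (\<beta> n) = w' (\<beta> n)"
        using that eq \<phi>_h by (intro dc_inj file_in \<beta>_in) metis+
    qed
    have "inj_on \<phi> W"
    proof (rule inj_onI)
      fix w w' assume ww: "w \<in> W" "w' \<in> W" and eq: "\<phi> w = \<phi> w'"
      show "w = w'"
      proof (rule PiE_ext)
        show "w \<in> {1..N} \<rightarrow>\<^sub>E bit_strings (F * c)" "w' \<in> {1..N} \<rightarrow>\<^sub>E bit_strings (F * c)"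
          using ww by (simp_all add: W)
        fix n assume "n \<in> {1..N}"
        then have "inv \<beta> n \<in> {1..N}" "\<beta> (inv \<beta> n) = n"
          using permutes_in_image[OF permutes_inv[OF \<beta>]] permutes_inverses(1)[OF \<beta>] by auto
        then show "w n = w' n"
          using file_eq[OF ww, of "inv \<beta> n"] eq by simp
      qed
    qed
    moreover have "\<phi> ` W \<subseteq> W" using \<phi>_in by blast
    ultimately have bij: "bij_betw \<phi> W W"
      using endo_inj_surj[OF finW] by (simp add: bij_betw_def)

    \<comment> \<open>The two renamings of files cancel, since
      \<open>\<beta> \<circ> inv (snd g \<circ> \<beta>) = inv (snd g)\<close>: the base scheme sees
      the same input in both blocks.\<close>
    have blk_h: "blk (\<phi> w) (h g) = blk w g" if w: "w \<in> W" and g: "g \<in> S" for w g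
    proof
      fix n
      have s: "snd g permutes {1..N}" using g by (auto simp: S_def)
      show "blk (\<phi> w) (h g) n = blk w g n"
      proof (cases "n \<in> {1..N}")
        case True
        have "inv (snd g \<circ> \<beta>) n \<in> {1..N}"
          using True permutes_in_image[OF permutes_inv[OF permutes_compose[OF \<beta> s]]] by simp
        moreover have "\<beta> (inv (snd g \<circ> \<beta>) n) = inv (snd g) n"
          using permutes_inverses(1)[OF \<beta>]
          by (simp add: o_inv_distrib[OF permutes_bij[OF s] permutes_bij[OF \<beta>]])
        ultimately show ?thesis
          using True \<phi>_h[OF w _ g, of "inv (snd g \<circ> \<beta>) n"] by (simp add: blk_def h_def)
      qed (simp only: blk_def restrict_apply if_False)
    qed
    have cache_eq: "Z' (\<alpha> k) w = Z' (\<alpha> k) w' \<longleftrightarrow> Z' k (\<phi> w) = Z' k (\<phi> w')"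
      if k: "k \<in> {1..K}" and w: "w \<in> W" "w' \<in> W" for k w w'
    proof -
      have "\<alpha> k \<in> {1..K}" using permutes_in_image[OF \<alpha>] k by blast
      then have "Z' (\<alpha> k) w = Z' (\<alpha> k) w' \<longleftrightarrow>
          (\<forall>g\<in>S. Z (fst (h g) k) (blk (\<phi> w) (h g)) = Z (fst (h g) k) (blk (\<phi> w') (h g)))"
        using w by (simp add: Z'_eq blk_h) (simp add: h_def)
      also have "\<dots> \<longleftrightarrow> Z' k (\<phi> w) = Z' k (\<phi> w')"
        using k w \<phi>_in by (simp only: all_h[of "\<lambda>g. Z (fst g k) (blk (\<phi> w) g) = Z (fst g k) (blk (\<phi> w') g)"] Z'_eq)
      finally show ?thesis .
    qed
    have broadcast_eq: "X' (permute_demand K \<alpha> \<beta> d) w = X' (permute_demand K \<alpha> \<beta> d) w'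
        \<longleftrightarrow> X' d (\<phi> w) = X' d (\<phi> w')"
      if d: "d \<in> full_demands N K" and w: "w \<in> W" "w' \<in> W" for d w w'
    proof -
      let ?p = "\<lambda>g. permute_demand K (fst g) (snd g) d"
      have "permute_demand K (fst g) (snd g) (permute_demand K \<alpha> \<beta> d) = ?p (h g)" if "g \<in> S" for g
        using that \<alpha> by (auto simp: S_def h_def permute_demand_comp)
      then have "X' (permute_demand K \<alpha> \<beta> d) w = X' (permute_demand K \<alpha> \<beta> d) w' \<longleftrightarrow>
          (\<forall>g\<in>S. X (?p (h g)) (blk (\<phi> w) (h g)) = X (?p (h g)) (blk (\<phi> w') (h g)))"
        using w permute_demand_in_full_demands[OF \<alpha> \<beta> d] by (simp add: X'_eq blk_h)
      also have "\<dots> \<longleftrightarrow> X' d (\<phi> w) = X' d (\<phi> w')"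
        using d w \<phi>_in by (simp only: all_h[of "\<lambda>g. X (?p g) (blk (\<phi> w) g) = X (?p g) (blk (\<phi> w') g)"] X'_eq)
      finally show ?thesis .
    qed
    show "norm_entropy N (F * c) (\<lambda>w. (\<lambda>n\<in>A. w n, \<lambda>k\<in>B. Z' k w, \<lambda>d\<in>E. X' d w)) =
        norm_entropy N (F * c)
          (\<lambda>w. (\<lambda>n\<in>A. w (\<beta> n), \<lambda>k\<in>B. Z' (\<alpha> k) w, \<lambda>d\<in>E. X' (permute_demand K \<alpha> \<beta> d) w))"
    proof (rule norm_entropy_bij_cong[symmetric, of \<phi>], unfold W_def[symmetric])
      show "bij_betw \<phi> W W" by (rule bij)
      fix w w' assume "w \<in> W" "w' \<in> W"
      then show "((\<lambda>n\<in>A. w (\<beta> n), \<lambda>k\<in>B. Z' (\<alpha> k) w, \<lambda>d\<in>E. X' (permute_demand K \<alpha> \<beta> d) w) =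
          (\<lambda>n\<in>A. w' (\<beta> n), \<lambda>k\<in>B. Z' (\<alpha> k) w', \<lambda>d\<in>E. X' (permute_demand K \<alpha> \<beta> d) w')) \<longleftrightarrow>
          ((\<lambda>n\<in>A. \<phi> w n, \<lambda>k\<in>B. Z' k (\<phi> w), \<lambda>d\<in>E. X' d (\<phi> w)) =
          (\<lambda>n\<in>A. \<phi> w' n, \<lambda>k\<in>B. Z' k (\<phi> w'), \<lambda>d\<in>E. X' d (\<phi> w')))"
        unfolding prod.inject restrict_eq_iff
        by (intro arg_cong2[where f = "(\<and>)"] ball_cong refl file_eq cache_eq broadcast_eq)
          (use A B E in blast)+
    qed
  qed
  ultimately show ?thesis
    unfolding achievable_by_symmetric_schemes_def by blast
qed


subsection \<open>The linear scheme\<close>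

lemma UNIV_bit: "(UNIV :: bit set) = {0, 1}"
  by auto

instance bit :: finite
  by standard (simp add: UNIV_bit)

lemma card_UNIV_bit: "card (UNIV :: bit set) = 2"
  by (simp add: UNIV_bit)

type_synonym symbol = "bit \<times> bit"

text \<open>Multiplication by a generator of the multiplicative group of the field with four elements.\<close>

definition omega :: "symbol \<Rightarrow> symbol" where
  "omega x = (snd x, fst x + snd x)"

lemma additive_omega: "Modules.additive omega"
  by (simp only: Modules.additive_def omega_def prod_eq_iff fst_add snd_add fst_conv snd_conv
      add_ac simp_thms)

text \<open>In characteristic 2 this is the equation \<open>1 = omega + omega^2\<close> of a
  generator. It is the reason for four elements: over two elements the only nonzero weight is 1, and
  an even number of ones adds up to 0.\<close>

lemma omega_sum: "omega x + omega (omega x) = x"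
  by (cases x; cases "fst x"; cases "snd x") (simp_all add: omega_def)

lemma inj_omega: "inj omega"
  by (auto simp: inj_def omega_def)

text \<open>For an added index, the weight of an old one is split by \<open>1 = \<omega> + \<omega>\<^sup>2\<close>.\<close>

lemma ex_injective_weights:
  assumes "finite A" "A \<noteq> {}"
  shows "\<exists>t :: 'i \<Rightarrow> symbol \<Rightarrow> symbol. (\<forall>i. Modules.additive (t i) \<and> inj (t i)) \<and> (\<forall>x. (\<Sum>i\<in>A. t i x) = x)"
  using assms
proof (induction rule: finite_ne_induct)
  case (singleton a)
  have "Modules.additive (\<lambda>x :: symbol. x)" by (simp add: Modules.additive_def)
  then show ?case by (intro exI[of _ "\<lambda>_ x. x"]) simp
next
  case (insert a A)
  then obtain t :: "'i \<Rightarrow> symbol \<Rightarrow> symbol" where t: "\<And>i. Modules.additive (t i)" "\<And>i. inj (t i)"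
      "\<And>x. (\<Sum>i\<in>A. t i x) = x" by blast
  obtain b where b: "b \<in> A" using insert by blast
  define s where "s = t(a := omega \<circ> t b, b := omega \<circ> (omega \<circ> t b))"
  have comp: "Modules.additive (omega \<circ> f)" "inj (omega \<circ> f)" if "Modules.additive f" "inj f" for f :: "symbol \<Rightarrow> symbol"
    using that additive_omega inj_omega
    by (simp_all only: Modules.additive_def comp_apply inj_compose simp_thms)
  have "Modules.additive (s i) \<and> inj (s i)" for i
    using t comp by (simp add: s_def)
  moreover have "(\<Sum>i\<in>insert a A. s i x) = x" for x
  proof -
    have ab: "a \<noteq> b" "a \<notin> A" using b insert by auto
    have "(\<Sum>i\<in>insert a A. s i x) = s a x + (s b x + (\<Sum>i\<in>A - {b}. s i x))"
      using insert b by (simp add: sum.remove)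
    also have "(\<Sum>i\<in>A - {b}. s i x) = (\<Sum>i\<in>A - {b}. t i x)"
      using ab by (intro sum.cong) (auto simp: s_def)
    also have "s a x + (s b x + \<dots>) = t b x + (\<Sum>i\<in>A - {b}. t i x)"
      using ab omega_sum[of "t b x"] by (simp add: s_def add.assoc[symmetric])
    also have "\<dots> = x"
      using insert b t(3)[of x] by (simp add: sum.remove)
    finally show ?thesis .
  qed
  ultimately show ?case by blast
qed

text \<open>The users split into the groups requesting the same file, each nonempty because every
  file is requested. Weights are chosen for each group separately and glued together as
  \<open>t (d i) i\<close>.\<close>

lemma ex_injective_demand_weights:
  assumes d: "d \<in> full_demands N K"
  shows "\<exists>t :: nat \<Rightarrow> symbol \<Rightarrow> symbol. (\<forall>i\<in>{1..K}. Modules.additive (t i) \<and> inj (t i)) \<and>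
    (\<forall>n\<in>{1..N}. \<forall>x. (\<Sum>i | i \<in> {1..K} \<and> d i = n. t i x) = x)"
proof -
  have "\<exists>t :: nat \<Rightarrow> symbol \<Rightarrow> symbol. (\<forall>i. Modules.additive (t i) \<and> inj (t i)) \<and>
      (\<forall>x. (\<Sum>i | i \<in> {1..K} \<and> d i = n. t i x) = x)" if "n \<in> {1..N}" for n
  proof (rule ex_injective_weights)
    have "n \<in> d ` {1..K}" using that d by (auto simp: full_demands_def)
    then show "{i. i \<in> {1..K} \<and> d i = n} \<noteq> {}" by blast
  qed simp
  then have "\<exists>t :: nat \<Rightarrow> nat \<Rightarrow> symbol \<Rightarrow> symbol. \<forall>n\<in>{1..N}.
      (\<forall>i. Modules.additive (t n i) \<and> inj (t n i)) \<and>
      (\<forall>x. (\<Sum>i | i \<in> {1..K} \<and> d i = n. t n i x) = x)"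
    by (intro bchoice ballI)
  then obtain t :: "nat \<Rightarrow> nat \<Rightarrow> symbol \<Rightarrow> symbol" where t:
      "\<And>n i. n \<in> {1..N} \<Longrightarrow> Modules.additive (t n i) \<and> inj (t n i)"
      "\<And>n x. n \<in> {1..N} \<Longrightarrow> (\<Sum>i | i \<in> {1..K} \<and> d i = n. t n i x) = x"
    by blast
  have "(\<Sum>i | i \<in> {1..K} \<and> d i = n. t (d i) i x) = (\<Sum>i | i \<in> {1..K} \<and> d i = n. t n i x)" for n x
    by (intro sum.cong) simp_all
  moreover have "d i \<in> {1..N}" if "i \<in> {1..K}" for i
    using d that by (auto simp: full_demands_def)
  ultimately show ?thesis
    using t by (intro exI[of _ "\<lambda>i. t (d i) i"]) simp
qed

text \<open>\<open>D n i c\<close> is the difference, between two possible file contents, of symbol \<open>c\<close> of part \<open>i\<close> of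
  file \<open>n\<close>. The uncoded cache shows that all parts except the one missed by user \<open>k\<close> differ by the
  same \<open>\<rho>\<close>, and subtracting \<open>\<rho>\<close> from all parts changes neither hypothesis on sums.\<close>

lemma parts_agree:
  fixes D :: "nat \<Rightarrow> nat \<Rightarrow> nat \<Rightarrow> symbol" and t :: "nat \<Rightarrow> symbol \<Rightarrow> symbol"
  assumes d: "d \<in> full_demands N K" and k: "k \<in> {1..K}"
    and t: "\<And>i. i \<in> {1..K} \<Longrightarrow> Modules.additive (t i)" "\<And>i. i \<in> {1..K} \<Longrightarrow> inj (t i)"
    and t_sum: "\<And>n x. n \<in> {1..N} \<Longrightarrow> (\<Sum>i | i \<in> {1..K} \<and> d i = n. t i x) = x"
    and known: "\<And>n i c. n \<in> {1..N} \<Longrightarrow> i \<in> {1..K} \<Longrightarrow> i \<noteq> k \<Longrightarrow> c \<in> {1..K} \<Longrightarrow> D n i c = \<rho> n c"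
    and coded: "(\<Sum>n\<in>{1..N}. D n k k - \<rho> n k) = 0"
    and broadcast: "\<And>c. c \<in> {1..K} \<Longrightarrow> (\<Sum>n\<in>{1..N}. D n c c) = (\<Sum>i\<in>{1..K}. t i (D (d i) i c))"
    and i: "i \<in> {1..K}" and c: "c \<in> {1..K}"
  shows "D (d k) i c = \<rho> (d k) c"
proof -
  define E where "E n i c = D n i c - \<rho> n c" for n i c
  have din: "d ` {1..K} = {1..N}" "\<And>i. i \<in> {1..K} \<Longrightarrow> d i \<in> {1..N}"
    using d by (auto simp: full_demands_def)
  have E0: "E n i c = 0" if "n \<in> {1..N}" "i \<in> {1..K}" "i \<noteq> k" for n i
    using that known c by (simp add: E_def)
  \<comment> \<open>Grouping the users by requested file makes the weights in each group add up to
    the identity; so a shift by \<open>\<rho>\<close> cancels between the two sides of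
    \<open>broadcast\<close>.\<close>
  have \<rho>: "(\<Sum>i\<in>{1..K}. t i (\<rho> (d i) c)) = (\<Sum>n\<in>{1..N}. \<rho> n c)"
  proof -
    have "(\<Sum>i\<in>{1..K}. t i (\<rho> (d i) c)) = (\<Sum>n\<in>{1..N}. \<Sum>i | i \<in> {1..K} \<and> d i = n. t i (\<rho> (d i) c))"
      by (subst sum.group) (use din in auto)
    also have "\<dots> = (\<Sum>n\<in>{1..N}. \<Sum>i | i \<in> {1..K} \<and> d i = n. t i (\<rho> n c))"
      by (intro sum.cong) auto
    finally show ?thesis using t_sum by simp
  qed
  have "(\<Sum>n\<in>{1..N}. E n c c) = (\<Sum>n\<in>{1..N}. D n c c) - (\<Sum>n\<in>{1..N}. \<rho> n c)"
    by (simp add: E_def sum_subtractf)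
  also have "\<dots> = (\<Sum>i\<in>{1..K}. t i (E (d i) i c))"
    using broadcast[OF c] \<rho> by (simp add: E_def sum_subtractf Modules.additive.diff[OF t(1)])
  \<comment> \<open>For \<open>i \<noteq> k\<close> the shifted part \<open>i\<close> vanishes in
    every file, so only the part of the requested file missing at user \<open>k\<close>
    survives.\<close>
  also have "\<dots> = (\<Sum>i\<in>{k}. t i (E (d i) i c))"
    using k E0 din by (intro sum.mono_neutral_right) (auto simp: Modules.additive.zero[OF t(1)])
  finally have "(\<Sum>n\<in>{1..N}. E n c c) = t k (E (d k) k c)" by simp
  \<comment> \<open>For \<open>c \<noteq> k\<close> the diagonal symbols lie in the parts known to
    user \<open>k\<close>; for \<open>c = k\<close> their sum is exactly the coded cache
    symbol.\<close>
  moreover have "(\<Sum>n\<in>{1..N}. E n c c) = 0"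
  proof (cases "c = k")
    case True
    then show ?thesis using coded by (simp add: E_def)
  next
    case False
    then show ?thesis using E0 c by simp
  qed
  ultimately have "t k (E (d k) k c) = t k 0"
    using k by (simp add: Modules.additive.zero[OF t(1)])
  then have "E (d k) k c = 0"
    using t(2)[OF k] by (simp add: inj_eq)
  then have "E (d k) i c = 0"
    using E0 din(2)[OF k] i by (cases "i = k") auto
  then show ?thesis by (simp add: E_def)
qed

section \<open>Parameters and decoding of the linear scheme\<close>

theorem theorem1:
  fixes N K :: nat
  assumes "2 \<le> K" and "1 \<le> N" and "N \<le> K"
  shows "achievable_by_symmetric_schemes N K
    (real N / real K * (real K - 2 + (real K - 2 + 1 / real N) / (real K - 1)),
     1 / (real K - 1))"
proof -
  \<comment> \<open>There are \<open>K - 1\<close> free parts of \<open>K\<close> symbols, and each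
    symbol has two bits.\<close>
  define F where "F = 2 * ((K - 1) * K)"
  define C :: "(nat \<times> nat \<Rightarrow> symbol) set" where "C = {1..<K} \<times> {1..K} \<rightarrow>\<^sub>E UNIV"
  \<comment> \<open>Part \<open>K\<close> is the normalized one and reads as 0; it occupies no space
    in \<open>C\<close>.\<close>
  define part where "part f i c = (if i < K then f (i, c) else 0)"
    for f :: "nat \<times> nat \<Rightarrow> symbol" and i c :: nat
  \<comment> \<open>The reference part for the differences at user \<open>k\<close>: any index other
    than \<open>k\<close>, which exists because \<open>K\<close> is at least 2.\<close>
  define j where "j k = (if k = K then 1 else K)" for k
  \<comment> \<open>Per file, \<open>K - 2\<close> difference vectors relative to part
    \<open>j k\<close> suffice for the \<open>K - 1\<close> parts other than part
    \<open>k\<close>.\<close>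
  define I where "I k = {1..N} \<times> ({1..K} - {k, j k}) \<times> {1..K}" for k
  define Z where "Z k v =
      (\<lambda>(n, i, c)\<in>I k. part (v n) i c - part (v n) (j k) c,
       \<Sum>n\<in>{1..N}. part (v n) k k - part (v n) (j k) k)"
    for k and v :: "nat \<Rightarrow> nat \<times> nat \<Rightarrow> symbol"
  have "\<forall>d\<in>full_demands N K. \<exists>t :: nat \<Rightarrow> symbol \<Rightarrow> symbol.
      (\<forall>i\<in>{1..K}. Modules.additive (t i) \<and> inj (t i)) \<and>
      (\<forall>n\<in>{1..N}. \<forall>x. (\<Sum>i | i \<in> {1..K} \<and> d i = n. t i x) = x)"
    by (intro ballI ex_injective_demand_weights)
  from bchoice[OF this] obtain t :: "demand \<Rightarrow> nat \<Rightarrow> symbol \<Rightarrow> symbol" where t: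
      "\<And>d i. d \<in> full_demands N K \<Longrightarrow> i \<in> {1..K} \<Longrightarrow> Modules.additive (t d i)"
      "\<And>d i. d \<in> full_demands N K \<Longrightarrow> i \<in> {1..K} \<Longrightarrow> inj (t d i)"
      "\<And>d n x. d \<in> full_demands N K \<Longrightarrow> n \<in> {1..N} \<Longrightarrow> (\<Sum>i | i \<in> {1..K} \<and> d i = n. t d i x) = x"
    by blast
  define X where "X d v = (\<lambda>c\<in>{1..K}.
      (\<Sum>n\<in>{1..N}. part (v n) c c) - (\<Sum>i\<in>{1..K}. t d i (part (v (d i)) i c)))"
    for d and v :: "nat \<Rightarrow> nat \<times> nat \<Rightarrow> symbol"

  obtain m where m: "K = m + 2"
    using assms(1) by (metis add.commute le_Suc_ex)
  have pow4: "(4::nat) ^ l = 2 ^ (2 * l)" for l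
    by (simp add: power_mult)

  show ?thesis
  proof (rule achievable_by_symmetrization)
    show "0 \<le> real N / real K * (real K - 2 + (real K - 2 + 1 / real N) / (real K - 1))"
      by (simp add: m)
    \<comment> \<open>The inner fraction is at most 1 because \<open>1 / N \<le> 1\<close>, so the
      bracket is at most \<open>K - 1\<close> and the cache size at most \<open>N\<close>.\<close>
    have "(real m + 1 / real N) / (real m + 1) \<le> 1"
      using assms(2) by (subst divide_le_eq_1_pos) simp_all
    moreover have "real K = real m + 2"
      by (simp add: m)
    ultimately have "real m + (real m + 1 / real N) / (real m + 1) \<le> real K"
      by linarith
    then have "real N / real K * (real m + (real m + 1 / real N) / (real m + 1)) \<le> real N / real K * real K"
      by (rule mult_left_mono) simp
    then show "real N / real K * (real K - 2 + (real K - 2 + 1 / real N) / (real K - 1)) \<le> real N"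
      by (simp add: m add.commute)
    show "0 \<le> 1 / (real K - 1)" "0 < F"
      using assms(1) by (simp_all add: F_def)
    show "finite C"
      unfolding C_def by (intro finite_PiE) auto
    show "card C = 2 ^ F"
      unfolding C_def F_def by (subst card_funcsetE) (simp_all add: card_UNIV_bit pow4)
  next
    fix k assume k: "k \<in> {1..K}"
    have jk: "j k \<in> {1..K}" "j k \<noteq> k"
      using k assms(1) by (auto simp: j_def)
    let ?T = "(I k \<rightarrow>\<^sub>E UNIV) \<times> UNIV :: ((nat \<times> nat \<times> nat \<Rightarrow> symbol) \<times> symbol) set"
    have fin: "finite ?T"
      by (intro finite_cartesian_product finite_PiE) (auto simp: I_def)
    have "card (I k) = N * (m * K)"
      using k jk by (simp add: I_def card_cartesian_product m)
    then have "card ?T = 4 ^ (N * (m * K)) * 4"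
      by (simp add: card_cartesian_product card_funcsetE card_UNIV_bit I_def)
    also have "\<dots> = 2 ^ (2 * (N * (m * K) + 1))"
      by (simp add: pow4 power_add)
    finally have "card ?T = 2 ^ (2 * (N * (m * K) + 1))" .
    moreover have "Z k ` ({1..N} \<rightarrow>\<^sub>E C) \<subseteq> ?T"
      by (auto simp: Z_def)
    ultimately show "card (Z k ` ({1..N} \<rightarrow>\<^sub>E C)) \<le> 2 ^ (2 * (N * (m * K) + 1))"
      using card_mono[OF fin] by metis
  next
    \<comment> \<open>With \<open>x = K - 2\<close> and \<open>y = N\<close> the cache size times
      \<open>F\<close> is exactly the number of cached bits: \<open>N * (K - 2) * K\<close>
      differences and one coded symbol, two bits each.\<close>
    have "y / (x + 2) * (x + (x + 1 / y) / (x + 1)) * (2 * ((x + 1) * (x + 2)))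
        = 2 * (y * (x * (x + 2)) + 1)" if "0 \<le> x" "0 < y" for x y :: real
      using that by (simp add: divide_simps) algebra
    from this[of "real m" "real N"]
    have "real N / (real m + 2) * (real m + (real m + 1 / real N) / (real m + 1)) * (2 * ((real m + 1) * (real m + 2)))
        = 2 * (real N * (real m * (real m + 2)) + 1)"
      using assms(2) by simp
    moreover have "real K = real m + 2" "real K - 2 = real m" "real K - 1 = real m + 1"
      by (simp_all add: m)
    moreover have "real F = 2 * ((real m + 1) * (real m + 2))"
      by (simp add: F_def m algebra_simps)
    ultimately show "real (2 * (N * (m * K) + 1)) \<le>
        real N / real K * (real K - 2 + (real K - 2 + 1 / real N) / (real K - 1)) * real F"
      by (simp only: of_nat_mult of_nat_add of_nat_numeral of_nat_1 order_refl)
  next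
    fix d
    have fin: "finite ({1..K} \<rightarrow>\<^sub>E (UNIV :: symbol set))"
      by (intro finite_PiE) auto
    have "card ({1..K} \<rightarrow>\<^sub>E (UNIV :: symbol set)) = 2 ^ (2 * K)"
      by (simp add: card_funcsetE card_UNIV_bit pow4)
    moreover have "X d ` ({1..N} \<rightarrow>\<^sub>E C) \<subseteq> {1..K} \<rightarrow>\<^sub>E UNIV"
      by (auto simp: X_def)
    ultimately show "card (X d ` ({1..N} \<rightarrow>\<^sub>E C)) \<le> 2 ^ (2 * K)"
      using card_mono[OF fin] by metis
  next
    \<comment> \<open>The \<open>K\<close> broadcast symbols take \<open>2 * K = F / (K - 1)\<close>
      bits, so the rate is met with equality.\<close>
    show "real (2 * K) \<le> 1 / (real K - 1) * real F"
      by (simp add: m F_def field_simps)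
  next
    fix d k v v'
    assume d: "d \<in> full_demands N K" and k: "k \<in> {1..K}"
      and v: "v \<in> {1..N} \<rightarrow>\<^sub>E C" "v' \<in> {1..N} \<rightarrow>\<^sub>E C"
      and cache: "Z k v = Z k v'" and broadcast: "X d v = X d v'"
    define D where "D n i c = part (v n) i c - part (v' n) i c" for n i c
    have jk: "j k \<in> {1..K}" "j k \<noteq> k"
      using k assms(1) by (auto simp: j_def)
    have dk: "d k \<in> {1..N}"
      using d k by (auto simp: full_demands_def)
    have agree: "D (d k) i c = D (d k) (j k) c" if "i \<in> {1..K}" "c \<in> {1..K}" for i c
    \<comment> \<open>The common shift \<open>\<rho>\<close> is the difference in the reference part
      \<open>j k\<close>.\<close>
    proof (rule parts_agree[where \<rho> = "\<lambda>n. D n (j k)", OF d k t(1)[OF d] t(2)[OF d] t(3)[OF d]])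
      fix n i c assume n: "n \<in> {1..N}" and i: "i \<in> {1..K}" "i \<noteq> k" and c: "c \<in> {1..K}"
      show "D n i c = D n (j k) c"
      proof (cases "i = j k")
        case False
        have "\<forall>(n, i, c)\<in>I k. part (v n) i c - part (v n) (j k) c = part (v' n) i c - part (v' n) (j k) c"
          using cache by (simp add: Z_def restrict_eq_iff case_prod_beta)
        moreover have "(n, i, c) \<in> I k"
          using n i c False by (simp add: I_def)
        ultimately have "part (v n) i c - part (v n) (j k) c = part (v' n) i c - part (v' n) (j k) c"
          by blast
        then show ?thesis
          unfolding D_def by (simp only: algebra_simps)
      qed simp
    next
      have "(\<Sum>n\<in>{1..N}. part (v n) k k - part (v n) (j k) k)
          = (\<Sum>n\<in>{1..N}. part (v' n) k k - part (v' n) (j k) k)"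
        using cache by (simp add: Z_def)
      then show "(\<Sum>n\<in>{1..N}. D n k k - D n (j k) k) = 0"
        unfolding D_def sum_subtractf by (simp only: algebra_simps add_0_left)
    next
      fix c assume c: "c \<in> {1..K}"
      have din: "d i \<in> {1..N}" if "i \<in> {1..K}" for i
        using d that by (auto simp: full_demands_def)
      have "(\<Sum>n\<in>{1..N}. part (v n) c c) - (\<Sum>i\<in>{1..K}. t d i (part (v (d i)) i c))
          = (\<Sum>n\<in>{1..N}. part (v' n) c c) - (\<Sum>i\<in>{1..K}. t d i (part (v' (d i)) i c))"
        using broadcast c unfolding X_def restrict_eq_iff by blast
      then have "(\<Sum>n\<in>{1..N}. D n c c) = (\<Sum>i\<in>{1..K}. t d i (part (v (d i)) i c) - t d i (part (v' (d i)) i c))"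
        unfolding D_def sum_subtractf by (simp only: algebra_simps)
      also have "\<dots> = (\<Sum>i\<in>{1..K}. t d i (D (d i) i c))"
        using t(1)[OF d] by (intro sum.cong refl) (simp only: D_def Modules.additive.diff)
      finally show "(\<Sum>n\<in>{1..N}. D n c c) = (\<Sum>i\<in>{1..K}. t d i (D (d i) i c))" .
    qed (use that in simp_all)
    \<comment> \<open>All parts of the requested file differ by the same vector, and part
      \<open>K\<close> is 0 in both contents; so the normalization forces this vector to be
      0.\<close>
    have D0: "D (d k) i c = 0" if "i \<in> {1..K}" "c \<in> {1..K}" for i c
      using agree[OF that] agree[of K c] that assms(1) by (simp add: D_def part_def)
    show "v (d k) = v' (d k)"
    proof (rule PiE_ext)
      show "v (d k) \<in> {1..<K} \<times> {1..K} \<rightarrow>\<^sub>E UNIV" "v' (d k) \<in> {1..<K} \<times> {1..K} \<rightarrow>\<^sub>E UNIV"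
        using PiE_mem[OF v(1) dk] PiE_mem[OF v(2) dk] by (simp_all only: C_def)
      fix p assume "p \<in> {1..<K} \<times> {1..K}"
      then show "v (d k) p = v' (d k) p"
        using D0[of "fst p" "snd p"] by (auto simp: D_def part_def)
    qed
  qed
qed

end
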